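(* There exists a length-preserving bijection $\theta: \mathrm{Av}(231\mid 12) \rightarrow \mathrm{Av}(321\mid 12)$.
   Context: Permutations are written in one-line notation. A permutation (or a sequence of distinct integers) contains a permutation $\tau$ of length $k$ as a pattern if it has a (not necessarily contiguous) subsequence of length $k$ whose entries are in the same relative order as those of $\tau$; otherwise it avoids $\tau$. For a permutation $\alpha$ of length three and a permutation $\beta$ of length two, the juxtaposition class $\mathrm{Av}(\alpha\mid\beta)$ is the set of all permutations $\pi$ (of any finite length) whose one-line notation can be written as a concatenation $\pi = AB$ of two (possibly empty) contiguous blocks, such that the prefix $A$ avoids $\alpha$ and the suffix $B$ avoids $\beta$. A map between sets of permutations is length-preserving if it maps each permutation of length $n$ to a permutation of length $n$, for every $n$. *)

theory Defs
  imports Main "HOL-Library.Sublist" "HOL-Combinatorics.Multiset_Permutations"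
begin

text \<open>
  A permutation of length \<open>n\<close> in one-line notation is an element of
  \<open>permutations_of_set {1..n}\<close>; the empty permutation (\<open>n = 0\<close>) is included.
\<close>

definition perms :: "nat list set" where
  "perms = (\<Union>n. permutations_of_set {1..n})"

definition same_relative_order :: "nat list \<Rightarrow> nat list \<Rightarrow> bool" where
  "same_relative_order xs ys \<longleftrightarrow>
     length xs = length ys \<and>
     (\<forall>i < length xs. \<forall>j < length xs. xs ! i < xs ! j \<longleftrightarrow> ys ! i < ys ! j)"

definition contains_pattern :: "nat list \<Rightarrow> nat list \<Rightarrow> bool" where
  "contains_pattern xs \<tau> \<longleftrightarrow> (\<exists>ys. subseq ys xs \<and> same_relative_order ys \<tau>)"

definition avoids :: "nat list \<Rightarrow> nat list \<Rightarrow> bool" where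
  "avoids xs \<tau> \<longleftrightarrow> \<not> contains_pattern xs \<tau>"

text \<open>
  The blocks \<open>A\<close> and \<open>B\<close> are sequences of distinct integers, not
  standardised to permutations; either may be empty.
\<close>

definition Av_juxt :: "nat list \<Rightarrow> nat list \<Rightarrow> nat list set" where
  "Av_juxt \<alpha> \<beta> =
     {\<pi> \<in> perms. \<exists>A B. \<pi> = A @ B \<and> avoids A \<alpha> \<and> avoids B \<beta>}"

definition length_preserving_on :: "nat list set \<Rightarrow> (nat list \<Rightarrow> nat list) \<Rightarrow> bool" where
  "length_preserving_on S f \<longleftrightarrow> (\<forall>\<pi>\<in>S. length (f \<pi>) = length \<pi>)"

end

theory Submission
  imports Defs
begin

text \<open>
  Among the ways of writing \<open>\<pi> = A @ B\<close> with \<open>B\<close> decreasing, the one with the shortest \<open>A\<close> takes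
  for \<open>B\<close> the maximal decreasing suffix. Avoidance passes to prefixes, so \<open>\<pi>\<close> lies in
  \<open>Av(\<alpha> | 12)\<close> iff this shortest \<open>A\<close> avoids \<open>\<alpha>\<close>. Whether \<open>B\<close> is the maximal decreasing suffix
  of \<open>A @ B\<close> depends, apart from \<open>B\<close>, only on the last entry of \<open>A\<close>. It is therefore enough to
  have a bijection between the \<open>231\<close>-avoiding and the \<open>321\<close>-avoiding arrangements of a given set
  which fixes the last entry; applying it to \<open>A\<close> and leaving \<open>B\<close> alone gives \<open>\<theta>\<close>.

  The bijection of Simion and Schmidt, which fixes all right-to-left minima, has this property.
  It is easiest to describe on reversed words, so that one compares \<open>132\<close> with \<open>123\<close> and
  left-to-right minima are fixed. Read a word from the left and let \<open>m\<close> be the smallest entry so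
  far. An entry above \<open>m\<close> in a \<open>132\<close>-avoider must be the smallest of the unused values above \<open>m\<close>,
  since a smaller one would come later and complete a \<open>132\<close>; in a \<open>123\<close>-avoider it must be the
  largest. Hence a word of either kind is determined by the places and values of its left-to-right
  minima (\<open>avoid_iff_greedy\<close>), and replacing one choice rule by the other is reversible
  (\<open>rebuild_greedy\<close>).

  Both patterns have the form \<open>a b c\<close> with \<open>a < b\<close>, \<open>a < c\<close> and \<open>P b c\<close>, where \<open>P\<close> is \<open>(>)\<close>
  or \<open>(<)\<close>. Keeping \<open>P\<close> as a parameter makes the construction symmetric in the two classes: the
  same lemma shows that the map is well defined in either direction and that the two directions are
  mutually inverse.
\<close>

section \<open>Patterns whose first entry is the least\<close>

definition avoid_least_first :: "(nat \<Rightarrow> nat \<Rightarrow> bool) \<Rightarrow> nat list \<Rightarrow> bool" where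
  "avoid_least_first P xs \<longleftrightarrow>
     \<not> (\<exists>a b c. subseq [a, b, c] xs \<and> a < b \<and> a < c \<and> P b c)"

lemma avoid_least_first_subseq:
  "avoid_least_first P ys \<Longrightarrow> subseq xs ys \<Longrightarrow> avoid_least_first P xs"
  unfolding avoid_least_first_def by (meson subseq_order.trans)

lemma subseq_pair_iff: "subseq [b, c] (y # ys) \<longleftrightarrow> b = y \<and> c \<in> set ys \<or> subseq [b, c] ys"
  by (cases "b = y") (auto simp: subseq_singleton_left dest: subseq_Cons')

lemma subseq_triple_iff:
  "subseq [a, b, c] (y # ys) \<longleftrightarrow> a = y \<and> subseq [b, c] ys \<or> subseq [a, b, c] ys"
  by (cases "a = y") (auto dest: subseq_Cons')

text \<open>
  An occurrence starting at \<open>m\<close> can be moved to start at \<open>y\<close>, because \<open>y\<close> is smaller and cannot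
  itself be one of the two larger entries.
\<close>

lemma avoid_least_first_Cons_less:
  assumes "y < m"
  shows "avoid_least_first P (m # y # ys) \<longleftrightarrow> avoid_least_first P (y # ys)"
proof
  show "avoid_least_first P (m # y # ys) \<Longrightarrow> avoid_least_first P (y # ys)"
    by (erule avoid_least_first_subseq) auto
next
  assume av: "avoid_least_first P (y # ys)"
  show "avoid_least_first P (m # y # ys)"
    unfolding avoid_least_first_def
  proof clarify
    fix a b c
    assume occ: "subseq [a, b, c] (m # y # ys)" and less: "a < b" "a < c" and "P b c"
    from occ consider "subseq [a, b, c] (y # ys)" | "a = m" "subseq [b, c] (y # ys)"
      unfolding subseq_triple_iff[of _ _ _ m] by blast
    then show False
    proof cases
      case 1
      with av less \<open>P b c\<close> show False
        unfolding avoid_least_first_def by blast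
    next
      case 2
      with less assms have "subseq [b, c] ys"
        by (auto simp: subseq_pair_iff)
      then have "subseq [y, b, c] (y # ys)"
        by simp
      moreover have "y < b" "y < c"
        using 2 less assms by auto
      ultimately show False
        using av \<open>P b c\<close> unfolding avoid_least_first_def by blast
    qed
  qed
qed

text \<open>
  Here \<open>y\<close> can be the first entry of an occurrence only if the smaller \<open>m\<close> can replace it, so the
  occurrences that involve \<open>y\<close> essentially are those of the form \<open>m y z\<close>.
\<close>

lemma avoid_least_first_Cons_greater:
  assumes "m < y"
  shows "avoid_least_first P (m # y # ys) \<longleftrightarrow>
           (\<forall>z\<in>set ys. m < z \<longrightarrow> \<not> P y z) \<and> avoid_least_first P (m # ys)"
proof
  assume av: "avoid_least_first P (m # y # ys)"
  have "avoid_least_first P (m # ys)"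
    using av by (rule avoid_least_first_subseq) auto
  moreover have "\<not> P y z" if "z \<in> set ys" "m < z" for z
  proof -
    have "subseq [m, y, z] (m # y # ys)"
      using that by (simp add: subseq_singleton_left)
    then show ?thesis
      using av that assms unfolding avoid_least_first_def by blast
  qed
  ultimately show "(\<forall>z\<in>set ys. m < z \<longrightarrow> \<not> P y z) \<and> avoid_least_first P (m # ys)"
    by blast
next
  assume *: "(\<forall>z\<in>set ys. m < z \<longrightarrow> \<not> P y z) \<and> avoid_least_first P (m # ys)"
  show "avoid_least_first P (m # y # ys)"
    unfolding avoid_least_first_def
  proof clarify
    fix a b c
    assume occ: "subseq [a, b, c] (m # y # ys)" and less: "a < b" "a < c" and "P b c"
    from occ consider "subseq [a, b, c] (m # ys)" | "a = y" "subseq [b, c] ys"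
      | "a = m" "b = y" "c \<in> set ys"
      unfolding subseq_triple_iff subseq_pair_iff by blast
    then show False
    proof cases
      case 1
      with * less \<open>P b c\<close> show False
        unfolding avoid_least_first_def by blast
    next
      case 2
      then have "subseq [m, b, c] (m # ys)"
        by simp
      moreover have "m < b" "m < c"
        using 2 less assms by auto
      ultimately show False
        using * \<open>P b c\<close> unfolding avoid_least_first_def by blast
    next
      case 3
      with * less \<open>P b c\<close> show False
        by blast
    qed
  qed
qed

section \<open>The Simion-Schmidt bijection\<close>

text \<open>
  The rule \<open>sel\<close> returns the one element of a finite set that may precede all others without
  creating a pair related by \<open>P\<close>: the minimum for \<open>(>)\<close>, the maximum for \<open>(<)\<close>.
\<close>

definition selects :: "(nat set \<Rightarrow> nat) \<Rightarrow> (nat \<Rightarrow> nat \<Rightarrow> bool) \<Rightarrow> bool" where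
  "selects sel P \<longleftrightarrow> (\<forall>U. finite U \<and> U \<noteq> {} \<longrightarrow> sel U \<in> U) \<and>
     (\<forall>U. finite U \<longrightarrow> (\<forall>y\<in>U. y = sel U \<longleftrightarrow> (\<forall>z\<in>U. \<not> P y z)))"

lemma selects_mem: "selects sel P \<Longrightarrow> finite U \<Longrightarrow> U \<noteq> {} \<Longrightarrow> sel U \<in> U"
  by (simp add: selects_def)

lemma selects_eq_iff:
  "selects sel P \<Longrightarrow> finite U \<Longrightarrow> y \<in> U \<Longrightarrow> y = sel U \<longleftrightarrow> (\<forall>z\<in>U. \<not> P y z)"
  by (simp add: selects_def)

lemma selects_Min: "selects Min (>)"
  unfolding selects_def by (auto simp: not_less intro: Min_eqI[symmetric])

lemma selects_Max: "selects Max (<)"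
  unfolding selects_def by (auto simp: not_less intro: Max_eqI[symmetric])

text \<open>
  The word \<open>xs\<close> uses up \<open>R\<close>, the values still available when \<open>m\<close> is the smallest entry read so
  far. A new minimum may be chosen freely; any other entry is forced by \<open>sel\<close>.
\<close>

fun greedy :: "(nat set \<Rightarrow> nat) \<Rightarrow> nat \<Rightarrow> nat set \<Rightarrow> nat list \<Rightarrow> bool" where
  "greedy sel m R [] \<longleftrightarrow> R = {}"
| "greedy sel m R (y # ys) \<longleftrightarrow> y \<in> R \<and>
     (if y < m then greedy sel y (R - {y}) ys
      else y = sel {z \<in> R. m < z} \<and> greedy sel m (R - {y}) ys)"

text \<open>
  From the input only the places and values of its left-to-right minima are kept; the other entries
  are chosen afresh by \<open>sel\<close> from the available values \<open>R\<close>.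
\<close>

fun rebuild :: "(nat set \<Rightarrow> nat) \<Rightarrow> nat \<Rightarrow> nat set \<Rightarrow> nat list \<Rightarrow> nat list" where
  "rebuild sel m R [] = []"
| "rebuild sel m R (y # ys) =
     (if y < m then y # rebuild sel y (R - {y}) ys
      else sel {z \<in> R. m < z} # rebuild sel m (R - {sel {z \<in> R. m < z}}) ys)"

lemma length_rebuild [simp]: "length (rebuild sel m R xs) = length xs"
  by (induction xs arbitrary: m R) simp_all

lemma greedy_distinct_set: "greedy sel m R xs \<Longrightarrow> distinct xs \<and> set xs = R"
proof (induction xs arbitrary: m R)
  case (Cons y ys)
  then have "y \<in> R" and "\<exists>m'. greedy sel m' (R - {y}) ys"
    by (auto split: if_splits)
  with Cons.IH show ?case
    by fastforce
qed simp

text \<open>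
  The condition on \<open>y\<close> in \<open>avoid_least_first_Cons_greater\<close> says that no available value above \<open>m\<close>
  is related to \<open>y\<close> by \<open>P\<close>, which singles out the choice of \<open>sel\<close>.
\<close>

lemma avoid_iff_greedy:
  assumes sel: "selects sel P"
  shows "distinct (m # xs) \<Longrightarrow> avoid_least_first P (m # xs) \<longleftrightarrow> greedy sel m (set xs) xs"
proof (induction xs arbitrary: m)
  case Nil
  show ?case
    by (simp add: avoid_least_first_def)
next
  case (Cons y ys)
  then have rest: "set (y # ys) - {y} = set ys"
    by auto
  show ?case
  proof (cases "y < m")
    case True
    then show ?thesis
      using Cons rest by (simp add: avoid_least_first_Cons_less)
  next
    case False
    with Cons.prems have "m < y"
      by auto
    let ?U = "{z \<in> set (y # ys). m < z}"
    have "y = sel ?U \<longleftrightarrow> (\<forall>z\<in>?U. \<not> P y z)"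
      by (rule selects_eq_iff[OF sel]) (use \<open>m < y\<close> in auto)
    moreover have "\<not> P y y"
      \<comment> \<open>a set with one element forces its own choice\<close>
      using selects_eq_iff[OF sel, of "{y}" y] selects_mem[OF sel, of "{y}"] by simp
    ultimately have "y = sel ?U \<longleftrightarrow> (\<forall>z\<in>set ys. m < z \<longrightarrow> \<not> P y z)"
      by auto
    moreover have "avoid_least_first P (m # ys) \<longleftrightarrow> greedy sel m (set ys) ys"
      using Cons by simp
    ultimately show ?thesis
      using \<open>m < y\<close> rest avoid_least_first_Cons_greater[OF \<open>m < y\<close>] by simp
  qed
qed

text \<open>
  In the course of the reconstruction the two sets of available values drift apart, but only above
  the current minimum \<open>m\<close>: below \<open>m\<close> they agree, so the same new minima are possible, and they
  have the same size, so an entry above \<open>m\<close> is available for one word iff it is for the other.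
\<close>

lemma rebuild_greedy:
  assumes sel': "selects sel' P'"
  shows "greedy sel m R xs \<Longrightarrow> finite R \<Longrightarrow> finite R' \<Longrightarrow> card R = card R' \<Longrightarrow>
    m \<notin> R \<Longrightarrow> m \<notin> R' \<Longrightarrow> (\<forall>z<m. z \<in> R \<longleftrightarrow> z \<in> R') \<Longrightarrow>
    greedy sel' m R' (rebuild sel' m R' xs) \<and> rebuild sel m R (rebuild sel' m R' xs) = xs"
proof (induction xs arbitrary: m R R')
  case Nil
  then show ?case
    by simp
next
  case (Cons y ys)
  note prems = Cons.prems
  have "y \<in> R"
    using prems(1) by simp
  show ?case
  proof (cases "y < m")
    case True
    then have "y \<in> R'"
      using \<open>y \<in> R\<close> prems by blast
    have "greedy sel' y (R' - {y}) (rebuild sel' y (R' - {y}) ys) \<and>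
        rebuild sel y (R - {y}) (rebuild sel' y (R' - {y}) ys) = ys"
      by (rule Cons.IH) (use True \<open>y \<in> R\<close> \<open>y \<in> R'\<close> prems in auto)
    then show ?thesis
      using True \<open>y \<in> R'\<close> by simp
  next
    case False
    then have "m < y"
      using \<open>y \<in> R\<close> prems by (metis linorder_neqE_nat)
    have "y = sel {z \<in> R. m < z} \<and> greedy sel m (R - {y}) ys"
      using prems(1) unfolding greedy.simps if_not_P[OF False] by blast
    then have y: "y = sel {z \<in> R. m < z}" and greedy: "greedy sel m (R - {y}) ys"
      by blast+
    have "{z \<in> R'. m < z} \<noteq> {}"
    proof
      assume "{z \<in> R'. m < z} = {}"
      then have "\<forall>z\<in>R'. z < m"
        using prems by (metis (mono_tags, lifting) empty_Collect_eq linorder_neqE_nat)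
      \<comment> \<open>then \<open>R'\<close> is a subset of \<open>R\<close> which misses \<open>y\<close>, contradicting equality of sizes\<close>
      then have "R' \<subset> R"
        using prems \<open>y \<in> R\<close> False by blast
      then show False
        using psubset_card_mono[of R R'] prems by simp
    qed
    define y' where "y' = sel' {z \<in> R'. m < z}"
    have "y' \<in> R'" "m < y'"
      using selects_mem[OF sel', of "{z \<in> R'. m < z}"] \<open>{z \<in> R'. m < z} \<noteq> {}\<close> prems
      by (auto simp: y'_def)
    have "greedy sel' m (R' - {y'}) (rebuild sel' m (R' - {y'}) ys) \<and>
        rebuild sel m (R - {y}) (rebuild sel' m (R' - {y'}) ys) = ys"
      by (rule Cons.IH) (use greedy \<open>m < y\<close> \<open>m < y'\<close> \<open>y \<in> R\<close> \<open>y' \<in> R'\<close> prems in auto)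
    then show ?thesis
      using False \<open>y' \<in> R'\<close> \<open>m < y'\<close> y by (simp flip: y'_def)
  qed
qed

section \<open>The juxtaposition with a monotone block\<close>

text \<open>
  Words are still reversed, so the maximal decreasing suffix has become the maximal increasing
  prefix. It ends at the first descent, after which the avoiding block starts.
\<close>

fun juxtaposed :: "(nat \<Rightarrow> nat \<Rightarrow> bool) \<Rightarrow> nat list \<Rightarrow> bool" where
  "juxtaposed P (x # y # zs) \<longleftrightarrow>
     (if x < y then juxtaposed P (y # zs) else avoid_least_first P (y # zs))"
| "juxtaposed P _ \<longleftrightarrow> True"

fun juxt_map :: "(nat set \<Rightarrow> nat) \<Rightarrow> nat list \<Rightarrow> nat list" where
  "juxt_map sel (x # y # zs) =
     (if x < y then x # juxt_map sel (y # zs) else x # y # rebuild sel y (set zs) zs)"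
| "juxt_map sel xs = xs"

lemma length_juxt_map [simp]: "length (juxt_map sel xs) = length xs"
  by (induction sel xs rule: juxt_map.induct) simp_all

lemma juxt_map_Cons: "\<exists>ys. juxt_map sel (x # xs) = x # ys"
  by (cases xs) auto

text \<open>
  Any other valid decomposition has a longer avoiding block, which contains the one used by
  \<open>juxtaposed\<close>.
\<close>

lemma juxtaposed_iff:
  "distinct xs \<Longrightarrow>
   (\<exists>B A. xs = B @ A \<and> sorted_wrt (<) B \<and> avoid_least_first P A) \<longleftrightarrow> juxtaposed P xs"
proof (induction P xs rule: juxtaposed.induct)
  case (1 P x y zs)
  show ?case
  proof
    assume "juxtaposed P (x # y # zs)"
    show "\<exists>B A. x # y # zs = B @ A \<and> sorted_wrt (<) B \<and> avoid_least_first P A"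
    proof (cases "x < y")
      case True
      with 1 \<open>juxtaposed P (x # y # zs)\<close> obtain B A
        where BA: "y # zs = B @ A" "sorted_wrt (<) B" "avoid_least_first P A"
        by auto
      then have "sorted_wrt (<) (x # B)"
        using True by (cases B) auto
      with BA show ?thesis
        by (metis append_Cons)
    next
      case False
      then have "x # y # zs = [x] @ (y # zs) \<and> sorted_wrt (<) [x] \<and> avoid_least_first P (y # zs)"
        using \<open>juxtaposed P (x # y # zs)\<close> by simp
      then show ?thesis
        by blast
    qed
  next
    assume "\<exists>B A. x # y # zs = B @ A \<and> sorted_wrt (<) B \<and> avoid_least_first P A"
    then obtain B A where BA: "x # y # zs = B @ A" "sorted_wrt (<) B" "avoid_least_first P A"
      by blast
    show "juxtaposed P (x # y # zs)"
    proof (cases B)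
      case Nil
      then have "avoid_least_first P (y # zs)"
        using BA by (auto elim: avoid_least_first_subseq)
      moreover from this have "\<exists>B A. y # zs = B @ A \<and> sorted_wrt (<) B \<and> avoid_least_first P A"
        by (intro exI[of _ "[]"] exI[of _ "y # zs"]) simp
      then have "juxtaposed P (y # zs)" if "x < y"
        using 1(1)[OF that] 1(2) by simp
      ultimately show ?thesis
        by simp
    next
      case (Cons b B')
      then have tl: "b = x" "y # zs = B' @ A" "sorted_wrt (<) B'" "\<forall>z\<in>set B'. x < z"
        using BA by auto
      show ?thesis
      proof (cases "x < y")
        case True
        have "juxtaposed P (y # zs)"
          using 1(1)[OF True] 1(2) tl BA(3) by (metis distinct.simps(2))
        with True show ?thesis
          by simp
      next
        case False
        with tl have "B' = []"
          by (cases B') auto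
        then have "avoid_least_first P (y # zs)"
          using tl BA(3) by simp
        with False show ?thesis
          by simp
      qed
    qed
  qed
next
  case ("2_1" P)
  show ?case
    by (auto simp: avoid_least_first_def)
next
  case ("2_2" P v)
  show ?case
    by (auto simp: avoid_least_first_def intro: exI[of _ "[v]"])
qed

text \<open>
  The first letter \<open>y\<close> of the avoiding block is its first left-to-right minimum, hence unchanged.
  So the descent in front of it stays where it is, and \<open>juxt_map sel\<close> cuts the new word at the
  same place.
\<close>

lemma juxt_map_correct:
  assumes sel: "selects sel P" and sel': "selects sel' P'"
  shows "distinct xs \<Longrightarrow> juxtaposed P xs \<Longrightarrow>
    distinct (juxt_map sel' xs) \<and> set (juxt_map sel' xs) = set xs \<and>
    juxtaposed P' (juxt_map sel' xs) \<and> juxt_map sel (juxt_map sel' xs) = xs"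
proof (induction xs rule: induct_list012)
  case (3 x y zs)
  show ?case
  proof (cases "x < y")
    case True
    obtain ws where ws: "juxt_map sel' (y # zs) = y # ws"
      using juxt_map_Cons by blast
    then show ?thesis
      using True 3 by auto
  next
    case False
    let ?ws = "rebuild sel' y (set zs) zs"
    have "greedy sel y (set zs) zs"
      using 3 False avoid_iff_greedy[OF sel, of y zs] by simp
    then have "greedy sel' y (set zs) ?ws \<and> rebuild sel y (set zs) ?ws = zs"
      by (rule rebuild_greedy[OF sel']) (use 3 in auto)
    moreover from this have ws: "distinct ?ws" "set ?ws = set zs"
      using greedy_distinct_set by auto
    ultimately have "avoid_least_first P' (y # ?ws)"
      using avoid_iff_greedy[OF sel', of y ?ws] 3 by simp
    with False 3 ws \<open>greedy sel' y (set zs) ?ws \<and> rebuild sel y (set zs) ?ws = zs\<close>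
    show ?thesis
      by simp
  qed
qed simp_all

section \<open>From patterns in permutations to reversed words\<close>

lemma subseq_revI: "subseq xs ys \<Longrightarrow> subseq (rev xs) (rev ys)"
  by (induction rule: list_emb.induct) (auto intro: list_emb_append_mono)

lemma subseq_rev_iff: "subseq xs (rev ys) \<longleftrightarrow> subseq (rev xs) ys"
  using subseq_revI[of "rev xs" ys] subseq_revI[of xs "rev ys"] by auto

lemma length_3_iff: "length ys = 3 \<longleftrightarrow> (\<exists>a b c. ys = [a, b, c])"
  by (auto simp: numeral_3_eq_3 length_Suc_conv)

lemma same_relative_order_231:
  "same_relative_order ys [2, 3, 1] \<longleftrightarrow> (\<exists>a b c. ys = [c, b, a] \<and> a < b \<and> a < c \<and> c < b)"
  (is "?L \<longleftrightarrow> ?R")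
proof
  assume L: ?L
  then obtain a b c where "ys = [c, b, a]"
    unfolding same_relative_order_def using length_3_iff[of ys] by auto
  with L show ?R
    by (auto simp: same_relative_order_def All_less_Suc)
next
  assume ?R
  then show ?L
    by (elim exE conjE) (simp add: same_relative_order_def All_less_Suc)
qed

lemma same_relative_order_321:
  "same_relative_order ys [3, 2, 1] \<longleftrightarrow> (\<exists>a b c. ys = [c, b, a] \<and> a < b \<and> a < c \<and> b < c)"
  (is "?L \<longleftrightarrow> ?R")
proof
  assume L: ?L
  then obtain a b c where "ys = [c, b, a]"
    unfolding same_relative_order_def using length_3_iff[of ys] by auto
  with L show ?R
    by (auto simp: same_relative_order_def All_less_Suc)
next
  assume ?R
  then show ?L
    by (elim exE conjE) (simp add: same_relative_order_def All_less_Suc)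
qed

lemma same_relative_order_12:
  "same_relative_order ys [1, 2] \<longleftrightarrow> (\<exists>a b. ys = [a, b] \<and> a < b)"
  (is "?L \<longleftrightarrow> ?R")
proof
  assume L: ?L
  then obtain a b where "ys = [a, b]"
    unfolding same_relative_order_def by (auto simp: length_Suc_conv)
  with L show ?R
    by (auto simp: same_relative_order_def All_less_Suc)
next
  assume ?R
  then show ?L
    by (elim exE conjE) (simp add: same_relative_order_def All_less_Suc)
qed

lemma avoids_231_iff: "avoids xs [2, 3, 1] \<longleftrightarrow> avoid_least_first (>) (rev xs)"
  unfolding avoids_def contains_pattern_def same_relative_order_231 avoid_least_first_def
    subseq_rev_iff by auto

lemma avoids_321_iff: "avoids xs [3, 2, 1] \<longleftrightarrow> avoid_least_first (<) (rev xs)"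
  unfolding avoids_def contains_pattern_def same_relative_order_321 avoid_least_first_def
    subseq_rev_iff by auto

lemma avoids_12_iff:
  assumes "distinct xs"
  shows "avoids xs [1, 2] \<longleftrightarrow> sorted_wrt (<) (rev xs)"
proof -
  have "avoids xs [1, 2] \<longleftrightarrow> (\<forall>a b. subseq [a, b] xs \<longrightarrow> \<not> a < b)"
    unfolding avoids_def contains_pattern_def same_relative_order_12 by auto
  also have "\<dots> \<longleftrightarrow> sorted_wrt (\<lambda>a b. \<not> a < b) xs"
  proof (induction xs)
    case (Cons x xs)
    then show ?case
      unfolding subseq_pair_iff sorted_wrt.simps by blast
  qed simp
  also have "\<dots> \<longleftrightarrow> sorted_wrt (\<lambda>a b. b < a) xs"
    using assms by (induction xs) (auto simp: not_less order.order_iff_strict)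
  finally show ?thesis
    by (simp add: sorted_wrt_rev)
qed

lemma mem_perms_iff: "\<pi> \<in> perms \<longleftrightarrow> distinct \<pi> \<and> (\<exists>n. set \<pi> = {1..n})"
  by (auto simp: perms_def permutations_of_set_def)

lemma mem_Av_juxt_iff:
  assumes \<alpha>: "\<And>xs. avoids xs \<alpha> \<longleftrightarrow> avoid_least_first P (rev xs)"
  shows "\<pi> \<in> Av_juxt \<alpha> [1, 2] \<longleftrightarrow> \<pi> \<in> perms \<and> juxtaposed P (rev \<pi>)"
proof (cases "distinct \<pi>")
  case True
  have "avoids B [1, 2] \<longleftrightarrow> sorted_wrt (<) (rev B)" if "\<pi> = A @ B" for A B
    using that True by (intro avoids_12_iff) simp
  then have "(\<exists>A B. \<pi> = A @ B \<and> avoids A \<alpha> \<and> avoids B [1, 2]) \<longleftrightarrow>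
      (\<exists>A B. \<pi> = A @ B \<and> sorted_wrt (<) (rev B) \<and> avoid_least_first P (rev A))"
    unfolding \<alpha> by blast
  also have "\<dots> \<longleftrightarrow>
      (\<exists>A B. rev \<pi> = rev B @ rev A \<and> sorted_wrt (<) (rev B) \<and> avoid_least_first P (rev A))"
    by (simp flip: rev_append)
  also have "\<dots> \<longleftrightarrow> (\<exists>B A. rev \<pi> = B @ A \<and> sorted_wrt (<) B \<and> avoid_least_first P A)"
    by (metis rev_rev_ident)
  also have "\<dots> \<longleftrightarrow> juxtaposed P (rev \<pi>)"
    using True by (simp add: juxtaposed_iff)
  finally show ?thesis
    by (simp add: Av_juxt_def)
qed (simp add: Av_juxt_def mem_perms_iff)

lemma juxt_map_Av_juxt:
  assumes sel: "selects sel P" "selects sel' P'"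
    and \<alpha>: "\<And>xs. avoids xs \<alpha> \<longleftrightarrow> avoid_least_first P (rev xs)"
    and \<alpha>': "\<And>xs. avoids xs \<alpha>' \<longleftrightarrow> avoid_least_first P' (rev xs)"
    and \<pi>: "\<pi> \<in> Av_juxt \<alpha> [1, 2]"
  shows "rev (juxt_map sel' (rev \<pi>)) \<in> Av_juxt \<alpha>' [1, 2]"
    and "rev (juxt_map sel (rev (rev (juxt_map sel' (rev \<pi>))))) = \<pi>"
proof -
  have "distinct (rev \<pi>)" "juxtaposed P (rev \<pi>)"
    using \<pi> unfolding mem_Av_juxt_iff[OF \<alpha>] mem_perms_iff by simp_all
  note correct = juxt_map_correct[OF sel this]
  show "rev (juxt_map sel' (rev \<pi>)) \<in> Av_juxt \<alpha>' [1, 2]"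
    using correct \<pi> unfolding mem_Av_juxt_iff[OF \<alpha>] mem_Av_juxt_iff[OF \<alpha>'] mem_perms_iff
    by simp
  show "rev (juxt_map sel (rev (rev (juxt_map sel' (rev \<pi>))))) = \<pi>"
    using correct by simp
qed

theorem theorem4:
  "\<exists>\<theta> :: nat list \<Rightarrow> nat list.
     bij_betw \<theta> (Av_juxt [2, 3, 1] [1, 2]) (Av_juxt [3, 2, 1] [1, 2]) \<and>
     length_preserving_on (Av_juxt [2, 3, 1] [1, 2]) \<theta>"
proof (intro exI conjI)
  let ?\<theta> = "\<lambda>\<pi>. rev (juxt_map Max (rev \<pi>))"
  let ?\<eta> = "\<lambda>\<pi>. rev (juxt_map Min (rev \<pi>))"
  note forth = juxt_map_Av_juxt[OF selects_Min selects_Max avoids_231_iff avoids_321_iff]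
  note converse = juxt_map_Av_juxt[OF selects_Max selects_Min avoids_321_iff avoids_231_iff]
  show "bij_betw ?\<theta> (Av_juxt [2, 3, 1] [1, 2]) (Av_juxt [3, 2, 1] [1, 2])"
    by (rule bij_betw_byWitness[where f' = ?\<eta>]) (use forth converse in blast)+
  show "length_preserving_on (Av_juxt [2, 3, 1] [1, 2]) ?\<theta>"
    by (simp add: length_preserving_on_def)
qed

end
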